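(* Let $\boldsymbol m,\boldsymbol l,k$ be consistent parameters, let $i\in\{0,\dots,r\}$ and let $w\in\mathcal S_{r+1}$ satisfy $w(0)=i$. Then $$v_i(\boldsymbol m,\boldsymbol l,k)=P(w\cdot\boldsymbol m,(w)_k\boldsymbol l,k),$$ where $P$ denotes the Jacobi-Piñeiro polynomial.
   Context: Fix $r\ge1$; put $l_0=k$, $l_{r+1}=0$. Parameters $\boldsymbol m=(m_1,\dots,m_r),\boldsymbol l=(l_1,\dots,l_r),k$ are consistent if all $m_i,l_i,k$ are non-negative integers, $k\ge l_1\ge\dots\ge l_r\ge0$ and $l_s-l_{s+1}\le m_s$ for $s=1,\dots,r$. Operators $D$: $e_i(\boldsymbol l,k)=k+\sum_{s=1}^im_s-l_i+l_{i+1}+i$, $D_i(\boldsymbol l,k)=x(x-1)\frac{d}{dx}-e_i(\boldsymbol l,k)(x-1)-k-1$ ($i=0,\dots,r$), $\boldsymbol 1_i\in\mathbb Z^r$ has $i$ ones followed by zeros, and $$D_{\boldsymbol m,\boldsymbol l,k}=D_{j(k)}\Big(\sum_{s=1}^{k-1}\boldsymbol 1_{j(s)},k-1\Big)\cdots D_{j(2)}(\boldsymbol 1_{j(1)},1)D_{j(1)}(\boldsymbol 0,0)$$ for any sequence $j(s)\in\{0,\dots,r\}$ with $\sum_{s=1}^k\boldsymbol 1_{j(s)}=\boldsymbol l$ (independent of the order). The polynomial $v_i(\boldsymbol m,\boldsymbol l,k)$ is the monic polynomial of degree $k-l_i+l_{i+1}$ proportional to $x^{-c_i}D_{\boldsymbol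 m,\boldsymbol l,k}(x^{c_i})$, $c_i=\sum_{j=1}^im_j+i$. (The functions $v_ix^{c_i}$, $i=0,\dots,r$, form a basis of the space $V(\boldsymbol m,\boldsymbol l,k)$, the unique $(r+1)$-dimensional space of polynomials with degrees $e_0<\dots<e_r$, orders of vanishing $c_0<\dots<c_r$ at $0$, and orders of vanishing $0,k+1,\dots,k+r$ at $1$.) Jacobi-Piñeiro polynomial: for $i=0,\dots,r$ let $$\tilde D_i(\boldsymbol m,\boldsymbol l,k)=x^{\sum_{j=1}^im_j+i}\,\frac{d^{\,l_i-l_{i+1}}}{dx^{\,l_i-l_{i+1}}}\,x^{l_i-l_{i+1}-\sum_{j=1}^im_j-i}$$ (composition of multiplication, differentiation, multiplication). $P(\boldsymbol m,\boldsymbol l,k)$ is the monic polynomial (of degree $l_1$, with coefficients rational functions of $\boldsymbol m,k$ over $\mathbb Q$) proportional to $$(x-1)^{k+1}\tilde D_r(\boldsymbol m,\boldsymbol l,k)\cdots\tilde D_1(\boldsymbol m,\boldsymbol l,k)\big((x-1)^{l_1-k-1}\big).$$ Weyl group: $\mathcal S_{r+1}$ is the group of permutations of $\{0,1,\dots,r\}$ with $(uv)(j)=u(v(j))$, generated by the transpositions $s_i$ of $i-1$ and $i$, $i=1,\dots,r$. It acts by $$s_i\cdot\boldsymbol m=(m_1,\dots,m_{i-2},m_{i-1}+m_i+1,-m_i-2,m_{i+1}+m_i+1,m_{i+2},\dots,m_r),$$ $$(s_i)_k\boldsymbol l=(l_1,\dots,l_{i-1},l_{i-1}+l_{i+1}-l_i,l_{i+1},\dots,l_r)$$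 (entries with index outside $1,\dots,r$ are omitted in the first formula). For products the convention is $(uv)\cdot\boldsymbol m=v\cdot(u\cdot\boldsymbol m)$ and $(uv)_k\boldsymbol l=(v)_k((u)_k\boldsymbol l)$; equivalently, $(l_j-l_{j+1})$ for $(w)_k\boldsymbol l$ equals $l_{w(j)}-l_{w(j)+1}$, and $c_j(w\cdot\boldsymbol m)=c_{w(j)}(\boldsymbol m)-c_{w(0)}(\boldsymbol m)$. *)

theory Defs
  imports "HOL-Analysis.Analysis" "HOL-Computational_Algebra.Polynomial"
    "HOL-Combinatorics.Permutations"
begin

text \<open>
  The vectors \<open>m = (m\<^sub>1, \<dots>, m\<^sub>r)\<close> and \<open>l = (l\<^sub>1, \<dots>, l\<^sub>r)\<close> are functions \<open>nat \<Rightarrow> int\<close> of which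
  only the values at \<open>1, \<dots>, r\<close> matter. They are integer valued because \<open>w \<cdot> m\<close> can have
  negative entries.
\<close>

text \<open>\<open>l\<close> extended by the conventions \<open>l\<^sub>0 = k\<close> and \<open>l\<^sub>r\<^sub>+\<^sub>1 = 0\<close>.\<close>

definition lext :: "nat \<Rightarrow> (nat \<Rightarrow> int) \<Rightarrow> int \<Rightarrow> nat \<Rightarrow> int" where
  "lext r l k j = (if j = 0 then k else if j \<le> r then l j else 0)"

definition consistent :: "nat \<Rightarrow> (nat \<Rightarrow> int) \<Rightarrow> (nat \<Rightarrow> int) \<Rightarrow> int \<Rightarrow> bool" where
  "consistent r m l k \<longleftrightarrow>
     0 \<le> k \<and> (\<forall>s\<in>{1..r}. 0 \<le> m s \<and> 0 \<le> l s) \<and>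
     (\<forall>s\<in>{0..r}. lext r l k (s + 1) \<le> lext r l k s) \<and>
     (\<forall>s\<in>{1..r}. lext r l k s - lext r l k (s + 1) \<le> m s)"

definition c_exp :: "(nat \<Rightarrow> int) \<Rightarrow> nat \<Rightarrow> int" where
  "c_exp m i = (\<Sum>j=1..i. m j) + int i"

definition e_exp :: "nat \<Rightarrow> (nat \<Rightarrow> int) \<Rightarrow> (nat \<Rightarrow> int) \<Rightarrow> int \<Rightarrow> nat \<Rightarrow> int" where
  "e_exp r m l k i =
     k + (\<Sum>s=1..i. m s) - lext r l k i + lext r l k (i + 1) + int i"


subsection \<open>The operators \<open>D\<close> and the polynomials \<open>v\<^sub>i\<close>\<close>

definition D_op ::
  "nat \<Rightarrow> (nat \<Rightarrow> int) \<Rightarrow> (nat \<Rightarrow> int) \<Rightarrow> int \<Rightarrow> nat \<Rightarrow> complex poly \<Rightarrow> complex poly" where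
  "D_op r m l k i p =
     [:0, 1:] * [:-1, 1:] * pderiv p
     - smult (of_int (e_exp r m l k i)) ([:-1, 1:] * p)
     - smult (of_int (k + 1)) p"

definition ones :: "nat \<Rightarrow> nat \<Rightarrow> int" where
  "ones i t = (if 1 \<le> t \<and> t \<le> i then 1 else 0)"

text \<open>
  A sequence \<open>j(1), \<dots>, j(k)\<close> is a list \<open>js\<close> with \<open>j(s + 1) = js ! s\<close>. The factor of \<open>j(1)\<close> is
  applied first.
\<close>

definition D_seq :: "nat \<Rightarrow> (nat \<Rightarrow> int) \<Rightarrow> nat list \<Rightarrow> complex poly \<Rightarrow> complex poly" where
  "D_seq r m js =
     fold (\<lambda>s. D_op r m (\<lambda>t. \<Sum>u<s. ones (js ! u) t) (int s) (js ! s)) [0..<length js]"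

definition admissible_seq :: "nat \<Rightarrow> (nat \<Rightarrow> int) \<Rightarrow> int \<Rightarrow> nat list \<Rightarrow> bool" where
  "admissible_seq r l k js \<longleftrightarrow>
     int (length js) = k \<and> set js \<subseteq> {0..r} \<and>
     (\<forall>t\<in>{1..r}. (\<Sum>u<length js. ones (js ! u) t) = l t)"

text \<open>The operator \<open>D\<^sub>m\<^sub>,\<^sub>l\<^sub>,\<^sub>k\<close> is the common value of the products over all admissible sequences.\<close>

definition D_prod ::
  "nat \<Rightarrow> (nat \<Rightarrow> int) \<Rightarrow> (nat \<Rightarrow> int) \<Rightarrow> int \<Rightarrow> complex poly \<Rightarrow> complex poly" where
  "D_prod r m l k = (THE T. \<forall>js. admissible_seq r l k js \<longrightarrow> T = D_seq r m js)"

text \<open>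
  Proportionality of \<open>p\<close> to \<open>x\<^bsup>-c\<^esup> D(x\<^bsup>c\<^esup>)\<close> is stated after multiplication by \<open>x\<^bsup>c\<^esup>\<close>. For consistent
  parameters \<open>c\<close> is non-negative, so \<open>nat\<close> does not truncate.
\<close>

definition v_poly ::
  "nat \<Rightarrow> (nat \<Rightarrow> int) \<Rightarrow> (nat \<Rightarrow> int) \<Rightarrow> int \<Rightarrow> nat \<Rightarrow> complex poly" where
  "v_poly r m l k i =
     (THE p. lead_coeff p = 1 \<and>
        int (degree p) = k - lext r l k i + lext r l k (i + 1) \<and>
        (\<exists>a. a \<noteq> 0 \<and>
           D_prod r m l k (monom 1 (nat (c_exp m i))) =
           smult a (monom 1 (nat (c_exp m i)) * p)))"


subsection \<open>Jacobi-Pineiro polynomials\<close>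

text \<open>
  The exponents can be negative, so the operators act on functions on the complex plane, whose
  values are meaningful away from \<open>0\<close> and \<open>1\<close>.
\<close>

definition Dt_op ::
  "nat \<Rightarrow> (nat \<Rightarrow> int) \<Rightarrow> (nat \<Rightarrow> int) \<Rightarrow> int \<Rightarrow> nat \<Rightarrow> (complex \<Rightarrow> complex) \<Rightarrow> complex \<Rightarrow> complex"
  where
  "Dt_op r m l k i f =
     (let d = lext r l k i - lext r l k (i + 1) in
      (\<lambda>x. x powi c_exp m i *
           (deriv ^^ nat d) (\<lambda>y. y powi (d - c_exp m i) * f y) x))"

definition JP_fun ::
  "nat \<Rightarrow> (nat \<Rightarrow> int) \<Rightarrow> (nat \<Rightarrow> int) \<Rightarrow> int \<Rightarrow> complex \<Rightarrow> complex" where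
  "JP_fun r m l k x =
     (x - 1) powi (k + 1) *
     fold (Dt_op r m l k) [1..<r + 1] (\<lambda>y. (y - 1) powi (l 1 - k - 1)) x"

text \<open>
  As an identity in \<open>m\<close> and \<open>k\<close>, \<open>JP_fun\<close> is a polynomial in \<open>x\<close> with coefficients polynomial in
  \<open>m\<close>, \<open>k\<close>, and its coefficient at \<open>x ^ l\<^sub>1\<close> is the product of the \<open>l\<^sub>1 - k - 1 + t - c\<^sub>i\<close> over
  \<open>1 \<le> i \<le> r\<close> and \<open>1 \<le> t \<le> l\<^sub>i - l\<^sub>i\<^sub>+\<^sub>1\<close>. Where this product is nonzero, the monic polynomial
  below is the value of the generic one with rational coefficients. This covers all
  parameters \<open>w \<cdot> m\<close>, \<open>(w)\<^sub>k l\<close>, \<open>k\<close> obtained from consistent \<open>m\<close>, \<open>l\<close>, \<open>k\<close>.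
\<close>

definition JP_poly :: "nat \<Rightarrow> (nat \<Rightarrow> int) \<Rightarrow> (nat \<Rightarrow> int) \<Rightarrow> int \<Rightarrow> complex poly" where
  "JP_poly r m l k =
     (THE p. lead_coeff p = 1 \<and> int (degree p) = l 1 \<and>
        (\<exists>a. a \<noteq> 0 \<and> (\<forall>x. x \<noteq> 0 \<and> x \<noteq> 1 \<longrightarrow> JP_fun r m l k x = a * poly p x)))"


subsection \<open>Weyl group actions\<close>

definition s_act_m :: "nat \<Rightarrow> nat \<Rightarrow> (nat \<Rightarrow> int) \<Rightarrow> nat \<Rightarrow> int" where
  "s_act_m r i m =
     (\<lambda>j. if j = i then - m i - 2
          else if j \<in> {1..r} \<and> (j + 1 = i \<or> j = i + 1) then m j + m i + 1
          else m j)"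

definition s_act_l :: "nat \<Rightarrow> int \<Rightarrow> nat \<Rightarrow> (nat \<Rightarrow> int) \<Rightarrow> nat \<Rightarrow> int" where
  "s_act_l r k i l = l(i := lext r l k (i - 1) + lext r l k (i + 1) - l i)"

text \<open>
  A list \<open>[i\<^sub>1, \<dots>, i\<^sub>n]\<close> represents \<open>s\<^bsub>i\<^sub>1\<^esub> \<cdots> s\<^bsub>i\<^sub>n\<^esub>\<close>, where \<open>s\<^sub>i\<close> transposes \<open>i - 1\<close> and \<open>i\<close>. By the
  convention \<open>(u v) \<cdot> m = v \<cdot> (u \<cdot> m)\<close> its leftmost factor acts first, which is the order of
  \<open>fold\<close>. The action of \<open>w\<close> is the common value over all words for \<open>w\<close>.
\<close>

definition word_perm :: "nat list \<Rightarrow> nat \<Rightarrow> nat" where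
  "word_perm is = foldr (\<lambda>i u. Transposition.transpose (i - 1) i \<circ> u) is id"

definition weyl_m :: "nat \<Rightarrow> (nat \<Rightarrow> nat) \<Rightarrow> (nat \<Rightarrow> int) \<Rightarrow> nat \<Rightarrow> int" where
  "weyl_m r w m =
     (THE m'. \<forall>is. set is \<subseteq> {1..r} \<and> word_perm is = w \<longrightarrow> m' = fold (s_act_m r) is m)"

definition weyl_l :: "nat \<Rightarrow> int \<Rightarrow> (nat \<Rightarrow> nat) \<Rightarrow> (nat \<Rightarrow> int) \<Rightarrow> nat \<Rightarrow> int" where
  "weyl_l r k w l =
     (THE l'. \<forall>is. set is \<subseteq> {1..r} \<and> word_perm is = w \<longrightarrow> l' = fold (s_act_l r k) is l)"

end

theory Submission
  imports Defs
begin

text \<open>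
  Write \<open>\<theta> = x d/dx\<close>, \<open>c\<^sub>j\<close> for \<open>c_exp m j\<close> and \<open>n\<^sub>j = l\<^sub>j - l\<^sub>j\<^sub>+\<^sub>1\<close>, so that \<open>n\<^sub>0 + \<dots> + n\<^sub>r = k\<close>.
  Both sides of the theorem come from products of the commuting operators \<open>\<theta> - a\<close>.

  On the one side, conjugation by powers of \<open>x - 1\<close> straightens the operators \<open>D\<close>:
  \<open>D\<^sub>j(l, k) ((x - 1)\<^sup>k\<^sup>+\<^sup>1 f) = (x - 1)\<^sup>k\<^sup>+\<^sup>2 (\<theta> - (c\<^sub>j - n\<^sub>j - 1)) f\<close>. In an admissible sequence the successive
  occurrences of \<open>j\<close> see \<open>n\<^sub>j = 0, 1, 2, \<dots>\<close> and contribute the roots \<open>c\<^sub>j - 1, c\<^sub>j - 2, \<dots>\<close>. Hence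
  the full product is \<open>(x - 1)\<^sup>k\<^sup>+\<^sup>1 \<Prod>\<^sub>j\<Prod>\<^sub>t (\<theta> - c\<^sub>j + t) (x - 1)\<^sup>-\<^sup>1\<close> with \<open>0 \<le> j \<le> r\<close> and
  \<open>1 \<le> t \<le> n\<^sub>j\<close>, whatever the order (lemma \<open>D_prod_eq_euler_chain\<close>). On the other side, the operator of
  the Jacobi-Pineiro formula with index \<open>j\<close> is exactly \<open>\<Prod>\<^sub>t (\<theta> - c\<^sub>j + t)\<close> (lemma
  \<open>Dt_op_euler_chain\<close>).

  Conjugation by \<open>x\<close> to the power \<open>c\<^sub>i\<close> replaces every \<open>c\<^sub>j\<close> by \<open>c\<^sub>j - c\<^sub>i\<close>, and the Weyl group action is made so
  that the pairs \<open>(c\<^sub>j - c\<^sub>i, n\<^sub>j)\<close> are the pairs belonging to \<open>w \<cdot> m\<close> and \<open>(w)\<^sub>k l\<close>, relabelled by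
  \<open>w\<close> (lemmas \<open>c_exp_weyl\<close> and \<open>lext_weyl\<close>). The index \<open>i = w(0)\<close> becomes the index \<open>0\<close>, whose
  factors \<open>(\<theta> + 1) \<cdots> (\<theta> + n)\<close>, \<open>n = n\<^sub>i\<close>, turn \<open>(x - 1)\<^sup>-\<^sup>1\<close> into a nonzero multiple of
  \<open>(x - 1)\<^sup>-\<^sup>n\<^sup>-\<^sup>1\<close> (lemma \<open>euler_chain_block_0\<close>). This is the function to which the Jacobi-Pineiro
  operators with indices \<open>1, \<dots>, r\<close> are applied. So both polynomials are proportional to the same
  polynomial.

  There remains the degree: the leading coefficient of that polynomial is a product of
  factors that could vanish. For consistent parameters they do not: the \<open>c\<^sub>j\<close> are at least
  \<open>m\<^sub>j + 1\<close> apart from all earlier ones, while \<open>n\<^sub>j \<le> m\<^sub>j\<close> (lemma \<open>block_nonresonant\<close>).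
\<close>

section \<open>Euler factors\<close>

text \<open>
  This is the numerator of \<open>(x d/dx - a) (q (x - 1)\<^sup>-\<^sup>s\<^sup>-\<^sup>1)\<close> over the denominator \<open>(x - 1)\<^sup>s\<^sup>+\<^sup>2\<close>. Recording
  numerators keeps the calculation among polynomials; only the Jacobi-Pineiro side, which is
  given by derivatives of functions, has to return to the fractions.
\<close>

definition euler_num :: "nat \<Rightarrow> int \<Rightarrow> complex poly \<Rightarrow> complex poly" where
  "euler_num s a q =
     [:0, 1:] * [:-1, 1:] * pderiv q - of_int a * [:-1, 1:] * q - of_nat (s + 1) * [:0, 1:] * q"

fun euler_chain :: "nat \<Rightarrow> int list \<Rightarrow> complex poly \<Rightarrow> complex poly" where
  "euler_chain s [] q = q"
| "euler_chain s (a # as) q = euler_chain (Suc s) as (euler_num s a q)"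

lemma pderiv_of_int [simp]: "pderiv (of_int a :: complex poly) = 0"
  by (simp add: of_int_poly)

text \<open>The operators \<open>x d/dx - a\<close> and \<open>x d/dx - b\<close> commute; \<open>s\<close> only counts the factors applied.\<close>

lemma euler_num_commute:
  "euler_num (Suc s) b (euler_num s a q) = euler_num (Suc s) a (euler_num s b q)"
proof -
  define X :: "complex poly" where "X = [:0, 1:]"
  have X1: "[:-1, 1:] = X - 1"
    by (simp add: X_def one_pCons)
  have dX: "pderiv X = 1"
    by (simp add: X_def pderiv_pCons)
  show ?thesis
    unfolding euler_num_def X1 X_def[symmetric]
    by (simp add: pderiv_mult pderiv_diff pderiv_add dX) (simp add: algebra_simps)
qed

lemma euler_chain_append:
  "euler_chain s (as @ bs) q = euler_chain (s + length as) bs (euler_chain s as q)"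
  by (induction as arbitrary: s q) auto

lemma euler_chain_mset:
  assumes "mset as = mset bs"
  shows "euler_chain s as q = euler_chain s bs q"
proof -
  \<comment> \<open>With the counter \<open>s\<close> as part of the state, the factors are genuinely commuting maps.\<close>
  define step where "step = (\<lambda>a (s, q). (Suc s, euler_num s a q))"
  have chain: "fold step cs (t, p) = (t + length cs, euler_chain t cs p)" for cs t p
    by (induction cs arbitrary: t p) (auto simp: step_def)
  have "fold step as = fold step bs"
    by (rule fold_multiset_equiv) (auto simp: step_def fun_eq_iff euler_num_commute assms)
  then show ?thesis
    using chain[of as s q] chain[of bs s q] by simp
qed

lemma euler_num_smult: "euler_num s a (smult b q) = smult b (euler_num s a q)"
  by (simp only: euler_num_def pderiv_smult mult_smult_right smult_diff_right)

lemma euler_chain_smult: "euler_chain s as (smult b q) = smult b (euler_chain s as q)"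
  by (induction as arbitrary: s q) (auto simp: euler_num_smult)

text \<open>Conjugating \<open>\<theta> = x d/dx\<close> by \<open>x\<^sup>n\<close> gives \<open>\<theta> + n\<close>.\<close>

lemma euler_num_monom_mult:
  "euler_num s a (monom 1 n * q) = monom 1 n * euler_num s (a - int n) q"
proof -
  have X: "[:0, 1:] * pderiv (monom 1 n) = of_nat n * (monom 1 n :: complex poly)"
    by (cases n) (simp_all add: pderiv_monom of_nat_poly smult_monom del: of_nat_Suc flip: monom_Suc)
  have "[:0, 1:] * [:-1, 1:] * pderiv (monom 1 n * q) =
      [:-1, 1:] * ([:0, 1:] * pderiv (monom 1 n)) * q +
      monom 1 n * ([:0, 1:] * [:-1, 1:] * pderiv q)"
    by (simp only: pderiv_mult ring_distribs ac_simps)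
  also have "\<dots> = of_nat n * [:-1, 1:] * (monom 1 n * q) +
      monom 1 n * ([:0, 1:] * [:-1, 1:] * pderiv q)"
    by (subst X) (simp only: ac_simps)
  finally show ?thesis
    by (simp only: euler_num_def of_int_diff of_int_of_nat_eq ring_distribs ac_simps)
       (simp only: algebra_simps)
qed

lemma euler_chain_monom_mult:
  "euler_chain s as (monom 1 n * q) = monom 1 n * euler_chain s (map (\<lambda>a. a - int n) as) q"
  by (induction as arbitrary: s q) (auto simp: euler_num_monom_mult)

lemma coeff_euler_num_Suc:
  "coeff (euler_num s a q) (Suc d) =
     of_int (int d - a - int s - 1) * coeff q d + of_int (a - int d - 1) * coeff q (Suc d)"
proof -
  have "coeff (pCons 0 (pderiv q)) d = of_nat d * coeff q d"
    by (cases d) (auto simp: coeff_pderiv)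
  then show ?thesis
    by (simp add: euler_num_def coeff_pderiv of_int_poly of_nat_poly algebra_simps)
qed

text \<open>
  The fraction \<open>q (x - 1)\<^sup>-\<^sup>s\<^sup>-\<^sup>1\<close> behaves like \<open>x\<^sup>-\<^sup>n\<^sup>-\<^sup>1\<close> at infinity, where \<open>\<theta> - a\<close> multiplies by \<open>-n - 1 - a\<close>.
  The difference \<open>n = s - degree q\<close> is the same after the step, so it serves for a whole
  chain of factors.
\<close>

lemma degree_euler_num:
  assumes "q \<noteq> 0" and "s = n + degree q" and "a + int n + 1 \<noteq> 0"
  shows "euler_num s a q \<noteq> 0" and "degree (euler_num s a q) = Suc (degree q)"
proof -
  let ?d = "degree q"
  have "int ?d - a - int s - 1 = - (a + int n + 1)"
    using assms(2) by simp
  then have "coeff (euler_num s a q) (Suc ?d) = of_int (- (a + int n + 1)) * lead_coeff q"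
    by (simp only: coeff_euler_num_Suc) (simp add: coeff_eq_0)
  then have nz: "coeff (euler_num s a q) (Suc ?d) \<noteq> 0"
    using assms(1,3) by (simp del: of_int_minus of_int_add of_int_diff)
  then show "euler_num s a q \<noteq> 0"
    by auto
  have "coeff (euler_num s a q) i = 0" if "i > Suc ?d" for i
    using that by (cases i) (auto simp: coeff_euler_num_Suc coeff_eq_0)
  then have "degree (euler_num s a q) \<le> Suc ?d"
    by (intro degree_le) auto
  then show "degree (euler_num s a q) = Suc ?d"
    using le_degree[OF nz] by simp
qed

lemma degree_euler_chain:
  assumes "q \<noteq> 0" and "s = n + degree q" and "\<And>a. a \<in> set as \<Longrightarrow> a + int n + 1 \<noteq> 0"
  shows "euler_chain s as q \<noteq> 0 \<and> degree (euler_chain s as q) = degree q + length as"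
  using assms
proof (induction as arbitrary: s q)
  case (Cons a as)
  have "euler_num s a q \<noteq> 0" "degree (euler_num s a q) = Suc (degree q)"
    using degree_euler_num[of q s n a] Cons.prems by auto
  then show ?case
    using Cons.IH[of "euler_num s a q" "Suc s"] Cons.prems by simp
qed simp

text \<open>The roots of \<open>(\<theta> - c + 1) \<cdots> (\<theta> - c + n)\<close>.\<close>

definition block :: "int \<Rightarrow> nat \<Rightarrow> int list" where
  "block c n = map (\<lambda>t. c - int t) [1..<Suc n]"

lemma length_block [simp]: "length (block c n) = n"
  by (simp add: block_def)

lemma block_0 [simp]: "block c 0 = []"
  by (simp add: block_def)

lemma block_Suc: "block c (Suc n) = block c n @ [c - int n - 1]"
  by (simp add: block_def)

lemma map_diff_block: "map (\<lambda>a. a - b) (block c n) = block (c - b) n"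
  by (simp add: block_def)

text \<open>
  The product \<open>(\<theta> + 1) \<cdots> (\<theta> + n)\<close> is \<open>d\<^sup>n/dx\<^sup>n x\<^sup>n\<close>, and \<open>x\<^sup>n/(x - 1)\<close> differs from \<open>1/(x - 1)\<close> by a
  polynomial of degree below \<open>n\<close>. So \<open>1/(x - 1)\<close> is sent to a multiple of \<open>(x - 1)\<^sup>-\<^sup>n\<^sup>-\<^sup>1\<close>. In the
  induction each factor \<open>\<theta> + s + 1\<close> multiplies the numerator by \<open>-(s + 1)\<close>.
\<close>

lemma euler_chain_block_0:
  "\<exists>b. b \<noteq> 0 \<and> euler_chain 0 (block 0 n) 1 = [:b:]"
proof (induction n)
  case 0
  show ?case
    by (auto simp: one_pCons)
next
  case (Suc n)
  then obtain b where b: "b \<noteq> 0" "euler_chain 0 (block 0 n) 1 = [:b:]"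
    by blast
  have "euler_num n (- int n - 1) [:b:] = [:- of_nat (Suc n) * b:]"
    by (simp add: euler_num_def pderiv_pCons of_int_poly of_nat_poly algebra_simps)
  with b show ?case
    by (intro exI[of _ "- of_nat (Suc n) * b"])
       (simp add: block_Suc euler_chain_append del: of_nat_Suc)
qed

section \<open>The operators \<open>D\<close>\<close>

text \<open>The operator \<open>D\<^sub>j\<close> acts on \<open>(x - 1)\<^sup>s\<^sup>+\<^sup>1 f\<close> through \<open>(\<theta> - e\<^sub>j + s + 1) f\<close>.\<close>

lemma D_op_eq_euler_num:
  "D_op r m l (int s) j p =
     euler_num s (c_exp m j - (lext r l (int s) j - lext r l (int s) (j + 1)) - 1) p"
proof -
  define n where "n = lext r l (int s) j - lext r l (int s) (j + 1)"
  have e: "e_exp r m l (int s) j = int s + c_exp m j - n"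
    by (simp add: e_exp_def c_exp_def n_def)
  define X :: "complex poly" where "X = [:0, 1:]"
  have X1: "[:-1, 1:] = X - 1"
    by (simp add: X_def one_pCons)
  have sm: "smult (of_int a) p = of_int a * p" for a and p :: "complex poly"
    by (simp add: of_int_poly)
  show ?thesis
    unfolding D_op_def euler_num_def e n_def[symmetric] X1 X_def[symmetric] sm
    by (simp add: algebra_simps)
qed

text \<open>
  The partition built up by a sequence is conjugate to it: the entry \<open>t\<close> counts the terms that are at
  least \<open>t\<close>. Hence the jump at \<open>j\<close> is the multiplicity of \<open>j\<close> in the sequence.
\<close>

lemma lext_ones_sum:
  assumes "set js \<subseteq> {0..r}" and "t \<le> Suc r"
  shows "lext r (\<lambda>t. \<Sum>u<length js. ones (js ! u) t) (int (length js)) t =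
    (\<Sum>j\<leftarrow>js. if t \<le> j then 1 else 0)"
proof -
  have *: "(\<Sum>u<length js. ones (js ! u) t) = (\<Sum>j\<leftarrow>js. ones j t)"
    by (simp add: sum_list_sum_nth atLeast0LessThan)
  consider "t = 0" | "1 \<le> t" "t \<le> r" | "t = Suc r"
    using assms(2) by linarith
  then show ?thesis
  proof cases
    case 1
    then show ?thesis
      by (simp add: lext_def sum_list_triv)
  next
    case 2
    then have "lext r (\<lambda>t. \<Sum>u<length js. ones (js ! u) t) (int (length js)) t =
        (\<Sum>j\<leftarrow>js. ones j t)"
      by (simp add: lext_def *)
    with 2 show ?thesis
      by (simp add: ones_def)
  next
    case 3
    have "(\<Sum>j\<leftarrow>js. if Suc r \<le> j then 1 else 0) = (0::int)"
      using assms(1) by (induction js) auto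
    with 3 show ?thesis
      by (simp add: lext_def)
  qed
qed

lemma lext_ones_diff:
  assumes "set js \<subseteq> {0..r}" and "j \<le> r"
  shows "lext r (\<lambda>t. \<Sum>u<length js. ones (js ! u) t) (int (length js)) j -
      lext r (\<lambda>t. \<Sum>u<length js. ones (js ! u) t) (int (length js)) (j + 1) =
    int (count_list js j)"
proof -
  have "(\<Sum>i\<leftarrow>js. if j \<le> i then 1 else 0) - (\<Sum>i\<leftarrow>js. if Suc j \<le> i then 1 else 0) =
      int (count_list js j)"
    by (induction js) auto
  then show ?thesis
    using assms by (simp add: lext_ones_sum)
qed

lemma D_seq_snoc:
  "D_seq r m (js @ [j]) p =
     D_op r m (\<lambda>t. \<Sum>u<length js. ones (js ! u) t) (int (length js)) j (D_seq r m js p)"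
proof -
  have "fold (\<lambda>s. D_op r m (\<lambda>t. \<Sum>u<s. ones ((js @ [j]) ! u) t) (int s) ((js @ [j]) ! s))
      [0..<length js] p = D_seq r m js p"
    unfolding D_seq_def by (intro fold_cong) (auto simp: nth_append)
  then show ?thesis
    by (simp add: D_seq_def nth_append)
qed

text \<open>
  The term \<open>j\<close> contributes the root \<open>c\<^sub>j - n - 1\<close> when \<open>j\<close> has occurred \<open>n\<close> times before. The roots collected
  by all occurrences of \<open>j\<close> thus form a block that depends on the multiplicity of \<open>j\<close> alone.
\<close>

lemma D_seq_eq_euler_chain:
  assumes "set js \<subseteq> {0..r}"
  shows "\<exists>as. length as = length js \<and> (\<forall>p. D_seq r m js p = euler_chain 0 as p) \<and>
    mset as = (\<Sum>j\<in>{0..r}. mset (block (c_exp m j) (count_list js j)))"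
  using assms
proof (induction js rule: rev_induct)
  case Nil
  show ?case
    by (simp add: D_seq_def)
next
  case (snoc j js)
  then have js: "set js \<subseteq> {0..r}" and j: "j \<in> {0..r}"
    by auto
  from snoc.IH[OF js] obtain as where as: "length as = length js"
    "\<And>p. D_seq r m js p = euler_chain 0 as p"
    "mset as = (\<Sum>j\<in>{0..r}. mset (block (c_exp m j) (count_list js j)))"
    by blast
  define a where "a = c_exp m j - int (count_list js j) - 1"
  have "D_seq r m (js @ [j]) p = euler_chain 0 (as @ [a]) p" for p
    using js j by (simp add: D_seq_snoc D_op_eq_euler_num lext_ones_diff[simplified] as a_def euler_chain_append)
  moreover have "mset (as @ [a]) =
      (\<Sum>i\<in>{0..r}. mset (block (c_exp m i) (count_list (js @ [j]) i)))"
  proof -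
    have "(\<Sum>i\<in>{0..r}. mset (block (c_exp m i) (count_list (js @ [j]) i))) =
        (\<Sum>i\<in>{0..r}. mset (block (c_exp m i) (count_list js i)) + (if i = j then {#a#} else {#}))"
      by (intro sum.cong) (auto simp: block_Suc a_def)
    also have "\<dots> = mset as + {#a#}"
      using j by (simp add: sum.distrib as)
    finally show ?thesis
      by simp
  qed
  ultimately show ?case
    using as(1) by (intro exI[of _ "as @ [a]"]) simp
qed

lemma admissible_lext:
  assumes "admissible_seq r l k js" and "t \<le> Suc r"
  shows "lext r l k t = lext r (\<lambda>t. \<Sum>u<length js. ones (js ! u) t) (int (length js)) t"
  using assms by (auto simp: admissible_seq_def lext_def)

definition gap :: "nat \<Rightarrow> (nat \<Rightarrow> int) \<Rightarrow> int \<Rightarrow> nat \<Rightarrow> nat" where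
  "gap r l k j = nat (lext r l k j - lext r l k (j + 1))"

lemma int_gap:
  assumes "consistent r m l k" and "j \<le> r"
  shows "int (gap r l k j) = lext r l k j - lext r l k (j + 1)"
  using assms by (auto simp: gap_def consistent_def)

lemma admissible_count:
  assumes "admissible_seq r l k js" and "j \<le> r"
  shows "count_list js j = gap r l k j"
proof -
  have "set js \<subseteq> {0..r}"
    using assms(1) by (simp add: admissible_seq_def)
  from lext_ones_diff[OF this assms(2)] show ?thesis
    using admissible_lext[OF assms(1), of j] admissible_lext[OF assms(1), of "j + 1"] assms(2)
    by (simp add: gap_def)
qed

lemma sum_telescope_lext:
  assumes "t \<le> Suc r"
  shows "(\<Sum>j\<in>{t..r}. lext r l k j - lext r l k (j + 1)) = lext r l k t"
proof -
  have "(\<Sum>j = t..<Suc r. lext r l k (Suc j) - lext r l k j) = lext r l k (Suc r) - lext r l k t"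
    by (rule sum_Suc_diff') (use assms in simp)
  then have "(\<Sum>j = t..<Suc r. lext r l k j - lext r l k (Suc j)) = lext r l k t"
    by (simp add: sum_subtractf lext_def)
  then show ?thesis
    by (simp only: atLeastLessThanSuc_atLeastAtMost flip: Suc_eq_plus1)
qed

lemma admissible_exists:
  assumes "consistent r m l k"
  shows "\<exists>js. admissible_seq r l k js"
proof -
  define js where "js = concat (map (\<lambda>j. replicate (gap r l k j) j) [0..<Suc r])"
  have set: "set js \<subseteq> {0..r}"
    by (auto simp: js_def)
  have *: "(\<Sum>j\<leftarrow>js. if t \<le> j then 1 else 0) = lext r l k t" if "t \<le> Suc r" for t
  proof -
    have "(\<Sum>j\<leftarrow>concat (map (\<lambda>j. replicate (gap r l k j) j) xs). if t \<le> j then 1 else 0) =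
        (\<Sum>j\<leftarrow>xs. if t \<le> j then int (gap r l k j) else 0)" for xs
      by (induction xs) (auto simp: sum_list_replicate)
    then have "(\<Sum>j\<leftarrow>js. if t \<le> j then 1 else 0) =
        (\<Sum>j\<leftarrow>[0..<Suc r]. if t \<le> j then int (gap r l k j) else 0)"
      unfolding js_def by blast
    also have "\<dots> = (\<Sum>j\<in>{0..r}. if t \<le> j then int (gap r l k j) else 0)"
      by (simp only: interv_sum_list_conv_sum_set_nat set_upt atLeastLessThanSuc_atLeastAtMost)
    also have "\<dots> = (\<Sum>j\<in>{t..r}. int (gap r l k j))"
      by (intro sum.mono_neutral_cong_right) auto
    also have "\<dots> = (\<Sum>j\<in>{t..r}. lext r l k j - lext r l k (j + 1))"
      by (intro sum.cong) (use int_gap[OF assms] in auto)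
    also have "\<dots> = lext r l k t"
      by (rule sum_telescope_lext[OF that])
    finally show ?thesis .
  qed
  have "int (length js) = k"
    using *[of 0] lext_ones_sum[OF set, of 0] by (simp add: lext_def)
  moreover have "(\<Sum>u<length js. ones (js ! u) t) = l t" if "t \<in> {1..r}" for t
    using *[of t] lext_ones_sum[OF set, of t] that by (simp add: lext_def)
  ultimately have "admissible_seq r l k js"
    using set by (simp add: admissible_seq_def)
  then show ?thesis ..
qed

text \<open>
  Any two admissible sequences have the same multiset of roots, so the product of operators is well
  defined; and every list of these roots computes it.
\<close>

lemma D_prod_eq_euler_chain:
  assumes cons: "consistent r m l k"
    and mset: "mset as = (\<Sum>j\<in>{0..r}. mset (block (c_exp m j) (gap r l k j)))"
  shows "D_prod r m l k p = euler_chain 0 as p"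
proof -
  have seq: "D_seq r m js = euler_chain 0 as" if adm: "admissible_seq r l k js" for js
  proof -
    have "set js \<subseteq> {0..r}"
      using adm by (simp add: admissible_seq_def)
    from D_seq_eq_euler_chain[OF this, of m] obtain bs where
      bs: "\<And>p. D_seq r m js p = euler_chain 0 bs p"
      "mset bs = (\<Sum>j\<in>{0..r}. mset (block (c_exp m j) (count_list js j)))"
      by blast
    have "mset bs = mset as"
      unfolding bs(2) mset by (intro sum.cong) (auto simp: admissible_count[OF adm])
    then show ?thesis
      using bs(1) euler_chain_mset[of bs as] by (auto simp: fun_eq_iff)
  qed
  obtain js where js: "admissible_seq r l k js"
    using admissible_exists[OF cons] by blast
  have "D_prod r m l k = euler_chain 0 as"
    unfolding D_prod_def by (rule the_equality) (use seq js in auto)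
  then show ?thesis
    by simp
qed

section \<open>The operators \<open>Dt\<close>\<close>

lemma has_field_derivative_euler:
  fixes x :: complex
  assumes "x \<noteq> 0" and "x \<noteq> 1"
  shows "((\<lambda>y. y powi (b + 1) * (poly q y * (y - 1) powi (- int s - 1))) has_field_derivative
    x powi b * (poly (euler_num s (- b - 1) q) x * (x - 1) powi (- int (Suc s) - 1))) (at x)"
proof -
  have 1: "x powi (b + 1) = x powi b * x"
    using assms(1) by (simp add: power_int_add)
  have "- int s - 1 = (- int (Suc s) - 1) + 1"
    by simp
  then have 2: "(x - 1) powi (- int s - 1) = (x - 1) powi (- int (Suc s) - 1) * (x - 1)"
    using power_int_add[of "x - 1" "- int (Suc s) - 1" 1] assms(2) by (simp only: power_int_1_right) simp
  have 3: "- int s - 1 - 1 = - int (Suc s) - 1"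
    by simp
  define u where "u = (x - 1) powi (- int (Suc s) - 1)"
  define v where "v = x powi b"
  show ?thesis
    by (rule derivative_eq_intros refl poly_DERIV | use assms in force)+
       (simp only: 3 add_diff_cancel_right' 1 2 u_def[symmetric] v_def[symmetric],
        simp add: euler_num_def algebra_simps)
qed

text \<open>
  This is the factorisation \<open>x\<^sup>c d\<^sup>n/dx\<^sup>n x\<^sup>n\<^sup>-\<^sup>c = (\<theta> - c + 1) \<cdots> (\<theta> - c + n)\<close>. The innermost derivative comes off
  first: \<open>d/dx x\<^sup>n\<^sup>+\<^sup>1\<^sup>-\<^sup>c f = x\<^sup>n\<^sup>-\<^sup>c (\<theta> + n + 1 - c) f\<close>, which leaves the case of \<open>n\<close>
  derivatives. The formula for \<open>h\<close> is required only off \<open>{0, 1}\<close>; the complement of these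
  two points is open, so the derivatives of \<open>h\<close> on it are determined.
\<close>

lemma higher_deriv_euler_chain:
  assumes "\<And>y. y \<noteq> 0 \<Longrightarrow> y \<noteq> 1 \<Longrightarrow>
      h y = y powi (int n - c) * (poly q y * (y - 1) powi (- int s - 1))"
    and "x \<noteq> 0" and "x \<noteq> 1"
  shows "x powi c * (deriv ^^ n) h x =
    poly (euler_chain s (rev (block c n)) q) x * (x - 1) powi (- int (s + n) - 1)"
  using assms(1)
proof (induction n arbitrary: h s q)
  case 0
  show ?case
    using 0[OF assms(2,3)] assms(2) by (simp add: power_int_minus)
next
  case (Suc n)
  let ?q = "euler_num s (c - int n - 1) q"
  have deriv: "deriv h y = y powi (int n - c) * (poly ?q y * (y - 1) powi (- int (Suc s) - 1))"
    if y: "y \<noteq> 0" "y \<noteq> 1" for y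
  proof (rule DERIV_imp_deriv)
    have "((\<lambda>y. y powi (int (Suc n) - c) * (poly q y * (y - 1) powi (- int s - 1)))
        has_field_derivative
        y powi (int n - c) * (poly ?q y * (y - 1) powi (- int (Suc s) - 1))) (at y)"
      using has_field_derivative_euler[OF y, of "int n - c" q s] by (simp add: algebra_simps)
    then show "(h has_field_derivative
        y powi (int n - c) * (poly ?q y * (y - 1) powi (- int (Suc s) - 1))) (at y)"
      by (rule has_field_derivative_transform_within_open[where S = "- {0, 1}"])
         (use y Suc.prems in auto)
  qed
  have "x powi c * (deriv ^^ Suc n) h x = x powi c * (deriv ^^ n) (deriv h) x"
    by (simp only: funpow_Suc_right o_apply)
  also have "\<dots> = poly (euler_chain (Suc s) (rev (block c n)) ?q) x *
      (x - 1) powi (- int (Suc s + n) - 1)"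
    by (rule Suc.IH) (rule deriv)
  finally show ?case
    by (simp add: block_Suc)
qed

lemma Dt_op_euler_chain:
  assumes "lext r l k (i + 1) \<le> lext r l k i"
    and "\<And>y. y \<noteq> 0 \<Longrightarrow> y \<noteq> 1 \<Longrightarrow> f y = poly q y * (y - 1) powi (- int s - 1)"
    and "x \<noteq> 0" and "x \<noteq> 1"
  shows "Dt_op r m l k i f x = poly (euler_chain s (block (c_exp m i) (gap r l k i)) q) x *
    (x - 1) powi (- int (s + gap r l k i) - 1)"
proof -
  have d: "lext r l k i - lext r l k (i + 1) = int (gap r l k i)"
    using assms(1) by (simp add: gap_def)
  have "Dt_op r m l k i f x =
      poly (euler_chain s (rev (block (c_exp m i) (gap r l k i))) q) x *
      (x - 1) powi (- int (s + gap r l k i) - 1)"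
    unfolding Dt_op_def Let_def d nat_int
    by (rule higher_deriv_euler_chain) (use assms in auto)
  then show ?thesis
    using euler_chain_mset[of "rev (block (c_exp m i) (gap r l k i))"
        "block (c_exp m i) (gap r l k i)"] by simp
qed

lemma fold_Dt_op_euler_chain:
  fixes r m l k
  defines "bs \<equiv> \<lambda>n. concat (map (\<lambda>j. block (c_exp m j) (gap r l k j)) [1..<Suc n])"
  assumes "\<And>j. j \<le> n \<Longrightarrow> lext r l k (j + 1) \<le> lext r l k j"
    and "x \<noteq> 0" and "x \<noteq> 1"
  shows "fold (Dt_op r m l k) [1..<Suc n] (\<lambda>y. (y - 1) powi (- int s - 1)) x =
    poly (euler_chain s (bs n) 1) x * (x - 1) powi (- int (s + length (bs n)) - 1)"
  using assms(2-)
proof (induction n arbitrary: x)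
  case 0
  then show ?case
    by (simp add: bs_def)
next
  case (Suc n)
  have bs: "bs (Suc n) = bs n @ block (c_exp m (Suc n)) (gap r l k (Suc n))"
    by (simp add: bs_def)
  have "fold (Dt_op r m l k) [1..<Suc (Suc n)] (\<lambda>y. (y - 1) powi (- int s - 1)) x =
      Dt_op r m l k (Suc n) (fold (Dt_op r m l k) [1..<Suc n] (\<lambda>y. (y - 1) powi (- int s - 1))) x"
    by simp
  also have "\<dots> = poly (euler_chain (s + length (bs n))
      (block (c_exp m (Suc n)) (gap r l k (Suc n))) (euler_chain s (bs n) 1)) x *
      (x - 1) powi (- int (s + length (bs n) + gap r l k (Suc n)) - 1)"
    by (rule Dt_op_euler_chain) (use Suc in auto)
  finally show ?case
    by (simp add: bs euler_chain_append add.assoc)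
qed

section \<open>The Weyl group\<close>

lemma c_exp_0 [simp]: "c_exp m 0 = 0"
  by (simp add: c_exp_def)

lemma c_exp_Suc: "c_exp m (Suc j) = c_exp m j + m (Suc j) + 1"
  by (simp add: c_exp_def)

text \<open>
  In the coordinates \<open>c\<^sub>0, \<dots>, c\<^sub>r\<close> for \<open>m\<close> and \<open>l\<^sub>j - l\<^sub>j\<^sub>+\<^sub>1\<close> for \<open>l\<close> the Weyl group permutes indices.
  The \<open>c\<^sub>j\<close> are shifted afterwards to keep \<open>c\<^sub>0 = 0\<close>.
\<close>

lemma c_exp_s_act:
  assumes "i \<in> {1..r}" and "j \<le> r"
  shows "c_exp (s_act_m r i m) j =
    c_exp m (Transposition.transpose (i - 1) i j) - c_exp m (Transposition.transpose (i - 1) i 0)"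
  using assms(2)
proof (induction j)
  case 0
  show ?case by simp
next
  case (Suc j)
  obtain i' where i: "i = Suc i'" "i' < r"
    using assms(1) by (cases i) auto
  consider "Suc j = i'" | "j = i'" | "j = Suc i'" | "j < i'" "Suc j \<noteq> i'" | "j > Suc i'"
    by linarith
  then have "c_exp m (Transposition.transpose i' i (Suc j)) =
      c_exp m (Transposition.transpose i' i j) + s_act_m r i m (Suc j) + 1"
    using Suc.prems i(2)
    by cases (auto simp: i(1) s_act_m_def c_exp_Suc Transposition.transpose_def)
  then show ?case
    using Suc by (simp add: c_exp_Suc i(1))
qed

lemma lext_s_act:
  assumes "i \<in> {1..r}" and "j \<le> r"
  shows "lext r (s_act_l r k i l) k j - lext r (s_act_l r k i l) k (Suc j) =
    lext r l k (Transposition.transpose (i - 1) i j) -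
    lext r l k (Suc (Transposition.transpose (i - 1) i j))"
proof -
  obtain i' where i: "i = Suc i'" "i' < r"
    using assms(1) by (cases i) auto
  consider "j = i'" | "j = Suc i'" | "j < i'" | "j > Suc i'"
    by linarith
  then show ?thesis
    using assms(2) i(2) by cases (auto simp: i(1) s_act_l_def Transposition.transpose_def lext_def)
qed

lemma word_perm_Cons:
  "word_perm (i # is) = Transposition.transpose (i - 1) i \<circ> word_perm is"
  by (simp add: word_perm_def)

lemma word_perm_single: "word_perm [i] = Transposition.transpose (i - 1) i"
  by (simp add: word_perm_def)

lemma word_perm_append: "word_perm (xs @ ys) = word_perm xs \<circ> word_perm ys"
  by (induction xs) (auto simp: word_perm_def)

lemma word_perm_le:
  assumes "set is \<subseteq> {1..r}" and "j \<le> r"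
  shows "word_perm is j \<le> r"
  using assms by (induction "is") (auto simp: word_perm_def Transposition.transpose_def)

lemma c_exp_fold:
  assumes "set is \<subseteq> {1..r}" and "j \<le> r"
  shows "c_exp (fold (s_act_m r) is m) j = c_exp m (word_perm is j) - c_exp m (word_perm is 0)"
  using assms
proof (induction "is" arbitrary: m)
  case Nil
  show ?case by (simp add: word_perm_def)
next
  case (Cons i "is")
  then show ?case
    using word_perm_le[of "is" r j] word_perm_le[of "is" r 0]
    by (simp add: c_exp_s_act word_perm_Cons)
qed

lemma lext_fold:
  assumes "set is \<subseteq> {1..r}" and "j \<le> r"
  shows "lext r (fold (s_act_l r k) is l) k j - lext r (fold (s_act_l r k) is l) k (Suc j) =
    lext r l k (word_perm is j) - lext r l k (Suc (word_perm is j))"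
  using assms
proof (induction "is" arbitrary: l)
  case Nil
  show ?case by (simp add: word_perm_def)
next
  case (Cons i "is")
  then show ?case
    using word_perm_le[of "is" r j] by (simp add: lext_s_act word_perm_Cons)
qed

text \<open>
  The coordinates determine the entries at \<open>1, \<dots>, r\<close>; the other values of the two functions have to
  be followed separately, since the Weyl group actions are compared as functions on all indices.
\<close>

lemma fold_s_act_outside:
  assumes "set is \<subseteq> {1..r}" and "j \<notin> {1..r}"
  shows "fold (s_act_m r) is m j = m j" and "fold (s_act_l r k) is l j = l j"
proof -
  show "fold (s_act_m r) is m j = m j"
    using assms by (induction "is" arbitrary: m) (auto simp: s_act_m_def)
  show "fold (s_act_l r k) is l j = l j"
    using assms by (induction "is" arbitrary: l) (auto simp: s_act_l_def)
qed

lemma fold_s_act_m_cong: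
  assumes "set is \<subseteq> {1..r}" "set is' \<subseteq> {1..r}" "word_perm is = word_perm is'"
  shows "fold (s_act_m r) is m = fold (s_act_m r) is' m"
proof
  fix j
  let ?a = "fold (s_act_m r) is m" and ?b = "fold (s_act_m r) is' m"
  show "?a j = ?b j"
  proof (cases "j \<in> {1..r}")
    case True
    then obtain j' where j: "j = Suc j'" "j' < r"
      by (cases j) auto
    have "c_exp ?a t = c_exp ?b t" if "t \<le> r" for t
      using that assms by (simp add: c_exp_fold)
    from this[of j] this[of j'] j show ?thesis
      by (simp add: c_exp_Suc)
  qed (simp only: fold_s_act_outside assms not_False_eq_True)
qed

lemma fold_s_act_l_cong:
  assumes "set is \<subseteq> {1..r}" "set is' \<subseteq> {1..r}" "word_perm is = word_perm is'"
  shows "fold (s_act_l r k) is l = fold (s_act_l r k) is' l"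
proof
  fix j
  let ?a = "fold (s_act_l r k) is l" and ?b = "fold (s_act_l r k) is' l"
  have eq: "lext r ?a k t = lext r ?b k t" if "t \<le> r" for t
    using that
  proof (induction t)
    case (Suc t)
    then show ?case
      using lext_fold[OF assms(1), of t k l] lext_fold[OF assms(2), of t k l] assms(3) by simp
  qed (simp add: lext_def)
  show "?a j = ?b j"
  proof (cases "j \<in> {1..r}")
    case True
    with eq[of j] show ?thesis
      by (simp add: lext_def)
  qed (simp only: fold_s_act_outside assms not_False_eq_True)
qed

lemma weyl_m_word:
  assumes "set ws \<subseteq> {1..r}"
  shows "weyl_m r (word_perm ws) m = fold (s_act_m r) ws m"
  unfolding weyl_m_def
proof (rule the_equality, goal_cases)
  case 1
  show ?case
    by (intro allI impI fold_s_act_m_cong) (use assms in auto)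
next
  case (2 x)
  from 2[rule_format, of ws] assms show ?case
    by simp
qed

lemma weyl_l_word:
  assumes "set ws \<subseteq> {1..r}"
  shows "weyl_l r k (word_perm ws) l = fold (s_act_l r k) ws l"
  unfolding weyl_l_def
proof (rule the_equality, goal_cases)
  case 1
  show ?case
    by (intro allI impI fold_s_act_l_cong) (use assms in auto)
next
  case (2 x)
  from 2[rule_format, of ws] assms show ?case
    by simp
qed

text \<open>The step uses \<open>(a, b + 1) = (b, b + 1) (a, b) (b, b + 1)\<close> for \<open>a < b\<close>.\<close>

lemma transpose_word:
  assumes "a \<le> r" and "b \<le> r"
  shows "\<exists>is. set is \<subseteq> {1..r} \<and> word_perm is = Transposition.transpose a b"
proof -
  have *: "\<exists>is. set is \<subseteq> {1..r} \<and> word_perm is = Transposition.transpose a b"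
    if "a \<le> b" "b \<le> r" for a b
    using that
  proof (induction b rule: dec_induct)
    case base
    show ?case
      by (intro exI[of _ "[]"]) (simp add: word_perm_def)
  next
    case (step b)
    then obtain js where js: "set js \<subseteq> {1..r}" "word_perm js = Transposition.transpose a b"
      by auto
    show ?case
    proof (cases "a = b")
      case True
      then show ?thesis
        using step.prems by (intro exI[of _ "[Suc b]"]) (simp add: word_perm_def)
    next
      case False
      have "Transposition.transpose b (Suc b) \<circ> Transposition.transpose a b \<circ>
          Transposition.transpose b (Suc b) = Transposition.transpose a (Suc b)"
        using False step.hyps by (auto simp: fun_eq_iff Transposition.transpose_def)
      then have "word_perm ([Suc b] @ js @ [Suc b]) = Transposition.transpose a (Suc b)"
        by (simp only: word_perm_append word_perm_single js(2) diff_Suc_1 comp_assoc)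
      then show ?thesis
        using js(1) step.prems by (intro exI[of _ "[Suc b] @ js @ [Suc b]"]) auto
    qed
  qed
  show ?thesis
    using *[of a b] *[of b a] assms by (cases "a \<le> b") (auto simp: transpose_commute)
qed

lemma permutes_word:
  assumes "w permutes {0..r}"
  shows "\<exists>is. set is \<subseteq> {1..r} \<and> word_perm is = w"
  using assms finite_atLeastAtMost
proof (induction rule: permutes_induct)
  case id
  show ?case
    by (intro exI[of _ "[]"]) (simp add: word_perm_def)
next
  case (swap a b p)
  then obtain xs ys where "set xs \<subseteq> {1..r}" "word_perm xs = Transposition.transpose a b"
    "set ys \<subseteq> {1..r}" "word_perm ys = p"
    using transpose_word[of a r b] by auto
  then show ?case
    by (intro exI[of _ "xs @ ys"]) (simp add: word_perm_append)
qed

lemma c_exp_weyl: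
  assumes "w permutes {0..r}" and "j \<le> r"
  shows "c_exp (weyl_m r w m) j = c_exp m (w j) - c_exp m (w 0)"
proof -
  obtain ws where "set ws \<subseteq> {1..r}" "word_perm ws = w"
    using permutes_word[OF assms(1)] by blast
  then show ?thesis
    using weyl_m_word[of ws r m] c_exp_fold[of ws r j m] assms(2) by simp
qed

lemma lext_weyl:
  assumes "w permutes {0..r}" and "j \<le> r"
  shows "lext r (weyl_l r k w l) k j - lext r (weyl_l r k w l) k (Suc j) =
    lext r l k (w j) - lext r l k (Suc (w j))"
proof -
  obtain ws where "set ws \<subseteq> {1..r}" "word_perm ws = w"
    using permutes_word[OF assms(1)] by blast
  then show ?thesis
    using weyl_l_word[of ws r k l] lext_fold[of ws r j k l] assms(2) by simp
qed

section \<open>Comparison\<close>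

lemma mset_concat_map: "mset (concat (map f [a..<b])) = (\<Sum>j\<in>{a..<b}. mset (f j))"
  by (simp add: mset_concat comp_def interv_sum_list_conv_sum_set_nat)

text \<open>
  By consistency \<open>c\<^sub>u - c\<^sub>s \<ge> m\<^sub>u + 1\<close> for \<open>s < u\<close>. The number in question is \<open>c\<^sub>j - c\<^sub>i - t + n\<^sub>i + 1\<close> with
  \<open>1 \<le> t \<le> n\<^sub>j\<close>. For \<open>i < j\<close> it is positive because \<open>t \<le> n\<^sub>j \<le> m\<^sub>j\<close>. For \<open>j < i\<close> it is negative because
  \<open>n\<^sub>i \<le> m\<^sub>i\<close>; here \<open>j\<close> may be \<open>0\<close>, and \<open>n\<^sub>0\<close> has no bound by \<open>m\<close>.
\<close>

lemma block_nonresonant: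
  assumes cons: "consistent r m l k" and "i \<le> r" "j \<le> r" "j \<noteq> i"
    and "a \<in> set (block (c_exp m j - c_exp m i) (gap r l k j))"
  shows "a + int (gap r l k i) + 1 \<noteq> 0"
proof -
  have m: "0 \<le> m s" "int (gap r l k s) \<le> m s" if "1 \<le> s" "s \<le> r" for s
    using cons that int_gap[OF cons, of s] by (auto simp: consistent_def)
  have c: "c_exp m s + m t + 1 \<le> c_exp m t" if "s < t" "t \<le> r" for s t
    using that
  proof (induction t)
    case (Suc t)
    show ?case
    proof (cases "s = t")
      case False
      with Suc have "c_exp m s + m t + 1 \<le> c_exp m t" "0 \<le> m t"
        using m(1)[of t] by auto
      then show ?thesis
        by (simp add: c_exp_Suc)
    qed (simp add: c_exp_Suc)
  qed simp
  obtain t where t: "1 \<le> t" "t \<le> gap r l k j" "a = c_exp m j - c_exp m i - int t"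
    using assms(5) by (auto simp: block_def)
  show ?thesis
  proof (cases "i < j")
    case True
    with c[of i j] m(2)[of j] t assms(3) show ?thesis
      by simp
  next
    case False
    with c[of j i] m(2)[of i] t assms show ?thesis
      by simp
  qed
qed

lemma v_poly_eqI:
  assumes "p \<noteq> 0" and "b \<noteq> 0"
    and "int (degree p) = k - lext r l k i + lext r l k (i + 1)"
    and "D_prod r m l k (monom 1 (nat (c_exp m i))) = smult b (monom 1 (nat (c_exp m i)) * p)"
  shows "v_poly r m l k i = smult (inverse (lead_coeff p)) p"
  unfolding v_poly_def
proof (rule the_equality, goal_cases)
  case 1
  show ?case
    using assms by (auto intro!: exI[of _ "b * lead_coeff p"] simp: mult.assoc)
next
  case (2 q)
  then obtain a where a: "lead_coeff q = 1" "a \<noteq> 0"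
    "smult a (monom 1 (nat (c_exp m i)) * q) = smult b (monom 1 (nat (c_exp m i)) * p)"
    using assms(4) by auto
  have "monom 1 (nat (c_exp m i)) * smult a q = monom 1 (nat (c_exp m i)) * smult b p"
    using a(3) by simp
  then have eq: "smult a q = smult b p"
    by (subst (asm) mult_left_cancel) (auto simp: monom_eq_0_iff)
  from arg_cong[OF eq, of lead_coeff] a(1) have "a = b * lead_coeff p"
    by (simp only: lead_coeff_smult mult_1_right)
  then have "inverse a * b = inverse (lead_coeff p)"
    using assms(1,2) by simp
  moreover have "q = smult (inverse a * b) p"
    using arg_cong[OF eq, of "smult (inverse a)"] a(2) by simp
  ultimately show ?case
    by simp
qed

lemma JP_poly_eqI:
  assumes "p \<noteq> 0" and "int (degree p) = l 1"
    and "\<And>x. x \<noteq> 0 \<Longrightarrow> x \<noteq> 1 \<Longrightarrow> JP_fun r m l k x = poly p x"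
  shows "JP_poly r m l k = smult (inverse (lead_coeff p)) p"
  unfolding JP_poly_def
proof (rule the_equality, goal_cases)
  case 1
  show ?case
    using assms by (auto intro!: exI[of _ "lead_coeff p"])
next
  case (2 q)
  then obtain a where a: "lead_coeff q = 1" "a \<noteq> 0"
    "\<And>x. x \<noteq> 0 \<Longrightarrow> x \<noteq> 1 \<Longrightarrow> poly p x = a * poly q x"
    using assms(3) by metis
  have "p - smult a q = 0"
  proof (rule ccontr)
    assume "p - smult a q \<noteq> 0"
    then have "finite {x. poly (p - smult a q) x = 0}"
      by (rule poly_roots_finite)
    moreover have "- {0, 1} \<subseteq> {x. poly (p - smult a q) x = 0}"
      using a(3) by auto
    ultimately have "finite (- {0, 1} :: complex set)"
      by (rule rev_finite_subset)
    then show False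
      by (simp add: infinite_UNIV_char_0)
  qed
  then have "p = smult a q"
    by simp
  then show ?case
    using a(1,2) by simp
qed

theorem proposition4p6:
  fixes r i :: nat and m l :: "nat \<Rightarrow> int" and k :: int and w :: "nat \<Rightarrow> nat"
  assumes "1 \<le> r"
    and "consistent r m l k"
    and "i \<in> {0..r}"
    and "w permutes {0..r}"
    and "w 0 = i"
  shows "v_poly r m l k i = JP_poly r (weyl_m r w m) (weyl_l r k w l) k"
proof -
  note cons = assms(2) and w = assms(4,5)
  define m' where "m' = weyl_m r w m"
  define l' where "l' = weyl_l r k w l"
  define B where "B = (\<lambda>j. block (c_exp m' j) (gap r l' k j))"
  define n where "n = gap r l k i"
  define rest where "rest = concat (map B [1..<Suc r])"
  \<comment> \<open>The block of the index \<open>0\<close> has turned \<open>(x - 1)\<^sup>-\<^sup>1\<close> into a multiple of \<open>(x - 1)\<^sup>-\<^sup>n\<^sup>-\<^sup>1\<close>.\<close>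
  define P where "P = euler_chain n rest 1"
  have wle: "w j \<le> r" if "j \<le> r" for j
    using permutes_in_image[OF w(1), of j] that by simp
  have gap': "gap r l' k j = gap r l k (w j)" if "j \<le> r" for j
    using lext_weyl[OF w(1) that, of k l] by (simp add: gap_def l'_def)
  have diff': "lext r l' k j - lext r l' k (j + 1) = int (gap r l' k j)" if "j \<le> r" for j
    using lext_weyl[OF w(1) that, of k l] int_gap[OF cons wle[OF that]] gap'[OF that]
    by (simp add: l'_def)
  have B: "B j = block (c_exp m (w j) - c_exp m i) (gap r l k (w j))" if "j \<le> r" for j
    using that by (simp add: B_def gap' m'_def c_exp_weyl[OF w(1)] w(2))
  have B0: "B 0 = block 0 n"
    using B[of 0] by (simp add: w(2) n_def)
  have length_rest: "int (n + length rest) = k"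
  proof -
    have "n + length rest = (\<Sum>j\<in>{0..r}. gap r l' k j)"
    proof -
      have "length rest = (\<Sum>j\<in>{1..<Suc r}. gap r l' k j)"
        by (simp add: rest_def length_concat comp_def interv_sum_list_conv_sum_set_nat B_def)
      moreover have "n = gap r l' k 0"
        by (simp add: gap' w(2) n_def)
      ultimately show ?thesis
        by (simp add: sum.atLeast_Suc_atMost atLeastLessThanSuc_atLeastAtMost)
    qed
    then have "int (n + length rest) = (\<Sum>j\<in>{0..r}. lext r l' k j - lext r l' k (j + 1))"
      using diff' by simp
    also have "\<dots> = k"
      by (simp only: sum_telescope_lext le0) (simp add: lext_def)
    finally show ?thesis .
  qed
  have nonres: "a + int n + 1 \<noteq> 0" if "a \<in> set rest" for a
  proof -
    from that obtain j where j: "1 \<le> j" "j \<le> r" "a \<in> set (B j)"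
      by (auto simp: rest_def)
    have "w j \<noteq> i"
      using j(1) w permutes_inj[OF w(1)] by (auto dest: injD)
    then show ?thesis
      using block_nonresonant[OF cons _ wle[OF j(2)], of i a] j B[OF j(2)] assms(3)
      by (simp add: n_def)
  qed
  have P: "P \<noteq> 0" "degree P = length rest"
    using degree_euler_chain[of 1 n n rest] nonres by (auto simp: P_def)
  define c where "c = nat (c_exp m i)"
  have c: "int c = c_exp m i"
    using cons assms(3) by (auto simp: c_def c_exp_def consistent_def intro!: add_nonneg_nonneg sum_nonneg)
  \<comment> \<open>These are the roots of \<open>D_prod r m l k\<close>; the shift by \<open>c\<close> is undone on passing \<open>x\<^sup>c\<close>.\<close>
  define as where "as = map (\<lambda>a. a + int c) (B 0 @ rest)"
  have "as = concat (map (\<lambda>j. map (\<lambda>a. a + int c) (B j)) [0..<Suc r])"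
    by (simp add: as_def rest_def upt_conv_Cons map_concat comp_def del: upt_Suc)
  then have "mset as = (\<Sum>j\<in>{0..<Suc r}. mset (map (\<lambda>a. a + int c) (B j)))"
    by (simp only: mset_concat_map)
  also have "\<dots> = (\<Sum>j\<in>{0..r}. mset (block (c_exp m (w j)) (gap r l k (w j))))"
  proof (intro sum.cong atLeastLessThanSuc_atLeastAtMost)
    fix j assume "j \<in> {0..r}"
    then have "map (\<lambda>a. a + int c) (B j) = block (c_exp m (w j)) (gap r l k (w j))"
      using map_diff_block[of "- int c"] by (simp add: B c)
    then show "mset (map (\<lambda>a. a + int c) (B j)) =
        mset (block (c_exp m (w j)) (gap r l k (w j)))"
      by (rule arg_cong)
  qed
  also have "\<dots> = (\<Sum>j\<in>{0..r}. mset (block (c_exp m j) (gap r l k j)))"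
    by (rule sum.permute[OF w(1), symmetric, unfolded comp_def])
  finally have D: "D_prod r m l k p = euler_chain 0 as p" for p
    by (rule D_prod_eq_euler_chain[OF cons])
  obtain b where b: "b \<noteq> 0" "euler_chain 0 (block 0 n) 1 = [:b:]"
    using euler_chain_block_0 by blast
  have "D_prod r m l k (monom 1 c) = monom 1 c * euler_chain 0 (B 0 @ rest) 1"
    using D[of "monom 1 c"] euler_chain_monom_mult[of 0 as c 1] by (simp add: as_def comp_def)
  also have "euler_chain 0 (B 0 @ rest) 1 = smult b P"
    using b(2) euler_chain_smult[of n rest b 1] by (simp add: euler_chain_append B0 P_def)
  finally have "D_prod r m l k (monom 1 c) = smult b (monom 1 c * P)"
    by simp
  moreover have "int (degree P) = k - lext r l k i + lext r l k (i + 1)"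
    using length_rest P(2) int_gap[OF cons, of i] assms(3) by (simp add: n_def)
  ultimately have v: "v_poly r m l k i = smult (inverse (lead_coeff P)) P"
    using v_poly_eqI[OF P(1) b(1)] by (simp add: c_def)
  have l1: "l' 1 = k - int n"
    using diff'[of 0] assms(1) by (simp add: lext_def gap' w(2) n_def)
  have "JP_fun r m' l' k x = poly P x" if x: "x \<noteq> 0" "x \<noteq> 1" for x
  proof -
    have "fold (Dt_op r m' l' k) [1..<Suc r] (\<lambda>y. (y - 1) powi (- int n - 1)) x =
        poly P x * (x - 1) powi (- int (n + length rest) - 1)"
      unfolding P_def rest_def B_def
      by (rule fold_Dt_op_euler_chain) (use diff' x in force)+
    moreover have "l' 1 - k - 1 = - int n - 1" "- int (n + length rest) - 1 = - k - 1"
      using l1 length_rest by simp_all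
    ultimately
    have "JP_fun r m' l' k x = (x - 1) powi (k + 1) * (poly P x * (x - 1) powi (- k - 1))"
      by (simp only: JP_fun_def flip: Suc_eq_plus1)
    also have "\<dots> = poly P x * ((x - 1) powi (k + 1) * (x - 1) powi (- (k + 1)))"
      by (simp add: mult_ac)
    also have "(x - 1) powi (k + 1) * (x - 1) powi (- (k + 1)) = 1"
      using x by (subst power_int_add[symmetric]) auto
    finally show ?thesis
      by simp
  qed
  then have "JP_poly r m' l' k = smult (inverse (lead_coeff P)) P"
    using l1 length_rest P by (intro JP_poly_eqI) auto
  then show ?thesis
    using v by (simp add: m'_def l'_def)
qed

end
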